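(* Let $p\equiv 1\pmod 4$ be a prime. Let $X=\{(a,b)\in V\times V : a<b<\overline{a}<\overline{b}\}$, $Y=\{(a,b)\in V\times V : a<\overline{a}<b<\overline{b}\}$, $Z=\{(a,b)\in V\times V : a<b<\overline{b}<\overline{a}\}$. Then $|X|=|Y|=|Z|=(p-1)(p-5)/96$.
   Context: For an integer $x$, $\{x\}_p$ denotes the least nonnegative residue of $x$ modulo $p$, and $\widetilde{x}=p-\{x\}_p$ if $\{x\}_p>p/2$, while $\widetilde{x}=\{x\}_p$ if $\{x\}_p<p/2$. Let $t=\prod_{x=1}^{(p-1)/2}x$ (so $t^2\equiv-1\pmod p$). Let $V=\{x : 1\le x\le (p-1)/2,\ x<\widetilde{tx}\}$, and for $a\in V$ put $\overline{a}=\widetilde{ta}$; the pairs $(a,\overline{a})$, $a\in V$, partition $\{1,\ldots,(p-1)/2\}$. *)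

theory Defs
  imports Complex_Main "HOL-Number_Theory.Cong" "HOL-Computational_Algebra.Primes"
begin

text \<open>
  \<open>tilde p x\<close> is the distance from the integer \<open>x\<close> to the nearest multiple of \<open>p\<close>. Only odd \<open>p\<close>
  are of interest, so the residue is never equal to \<open>p / 2\<close>.
\<close>

definition tilde :: "int \<Rightarrow> int \<Rightarrow> int" where
  "tilde p x = (if real_of_int (x mod p) > real_of_int p / 2 then p - x mod p else x mod p)"

definition tval :: "int \<Rightarrow> int" where
  "tval p = \<Prod>{1..(p - 1) div 2}"

definition pbar :: "int \<Rightarrow> int \<Rightarrow> int" where
  "pbar p a = tilde p (tval p * a)"

definition V :: "int \<Rightarrow> int set" where
  "V p = {x. 1 \<le> x \<and> x \<le> (p - 1) div 2 \<and> x < tilde p (tval p * x)}"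

definition X :: "int \<Rightarrow> (int \<times> int) set" where
  "X p = {(a, b) \<in> V p \<times> V p. a < b \<and> b < pbar p a \<and> pbar p a < pbar p b}"

definition Y :: "int \<Rightarrow> (int \<times> int) set" where
  "Y p = {(a, b) \<in> V p \<times> V p. a < pbar p a \<and> pbar p a < b \<and> b < pbar p b}"

definition Z :: "int \<Rightarrow> (int \<times> int) set" where
  "Z p = {(a, b) \<in> V p \<times> V p. a < b \<and> b < pbar p b \<and> pbar p b < pbar p a}"

end

theory Submission
  imports Defs "HOL-Number_Theory.Residues"
begin

text \<open>
  Only \<open>t\<^sup>2 \<equiv> - 1\<close> modulo the odd number \<open>p\<close> matters. Let \<open>n = (p - 1) / 2\<close>, write \<open>bar x\<close> for the
  distance from \<open>t x\<close> to the nearest multiple of \<open>p\<close>, and regard the pairs \<open>{x, bar x}\<close> as chords on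
  the points \<open>1, \<dots>, n\<close>. Two chords cross (\<open>X\<close>), are separated (\<open>Y\<close>) or are nested (\<open>Z\<close>), so that
  \<open>|X| + |Y| + |Z| = n (n - 2) / 8\<close>.

  In each crossing or nested pair of chords, exactly two of the four endpoints lie strictly inside
  the other chord, hence \<open>2 (|X| + |Z|)\<close> is the sum of \<open>bar a - a - 1\<close> over all chords. Now
  \<open>|bar x - x|\<close> is the smaller of the distances from \<open>(t - 1) x\<close> and \<open>(t + 1) x\<close> to the nearest
  multiple of \<open>p\<close>. These distances are the two ends of a chord, because \<open>t (t - 1) \<equiv> - (t + 1)\<close>,
  and multiplication by the unit \<open>t - 1\<close> permutes the chords. So the chord lengths have the same sum
  as the left endpoints, and \<open>|X| + |Z| = n (n - 2) / 12\<close> follows.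

  The sum of \<open>sgn (y - x) sgn (bar y - bar x)\<close> over all points \<open>x\<close>, \<open>y\<close> is \<open>8 (|Y| - |Z|) - n\<close>.
  Distances to the nearest multiple of \<open>p\<close> compare like the values of \<open>- cos (2 \<pi> x / p)\<close>. Extending
  the sum to all residues and substituting \<open>x = v - u\<close>, \<open>y = v + u\<close>, the formula
  \<open>cos (v - u) - cos (v + u) = 2 sin u sin v\<close> turns it into the square of the sum of
  \<open>sgn (sin (2 \<pi> u / p)) sgn (sin (2 \<pi> t u / p))\<close>. That sum changes sign under \<open>u \<mapsto> t u\<close>, so it
  vanishes, and the terms with \<open>x = 0\<close> or \<open>y = 0\<close> account for the \<open>- n\<close>. Hence \<open>|Y| = |Z|\<close>.
\<close>

subsection \<open>Chord diagrams\<close>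

lemma sum_Times_linorder:
  fixes f :: "'a::linorder \<Rightarrow> 'a \<Rightarrow> 'b::comm_monoid_add"
  assumes "finite A"
  shows "(\<Sum>a\<in>A. \<Sum>b\<in>A. f a b)
    = (\<Sum>a\<in>A. f a a) + (\<Sum>(a, b)\<in>{(a, b) \<in> A \<times> A. a < b}. f a b + f b a)"
proof -
  define diag ascending descending where
    "diag = {(a, b) \<in> A \<times> A. a = b}" and "ascending = {(a, b) \<in> A \<times> A. a < b}" and
    "descending = {(a, b) \<in> A \<times> A. b < a}"
  have finite: "finite diag" "finite ascending" "finite descending"
    using assms by (auto intro: finite_subset[of _ "A \<times> A"]
        simp: diag_def ascending_def descending_def)
  have "(\<Sum>a\<in>A. \<Sum>b\<in>A. f a b) = (\<Sum>(a, b)\<in>diag \<union> (ascending \<union> descending). f a b)"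
    unfolding sum.cartesian_product
    by (rule sum.cong) (auto simp: diag_def ascending_def descending_def)
  also have "\<dots> = (\<Sum>(a, b)\<in>diag. f a b)
      + ((\<Sum>(a, b)\<in>ascending. f a b) + (\<Sum>(a, b)\<in>descending. f a b))"
    using finite by (subst sum.union_disjoint; (auto simp: diag_def ascending_def descending_def)?)+
  also have "(\<Sum>(a, b)\<in>diag. f a b) = (\<Sum>a\<in>A. f a a)"
    by (rule sum.reindex_bij_witness[where i = "\<lambda>a. (a, a)" and j = fst]) (auto simp: diag_def)
  also have "(\<Sum>(a, b)\<in>descending. f a b) = (\<Sum>(a, b)\<in>ascending. f b a)"
    by (rule sum.reindex_bij_witness[where i = prod.swap and j = prod.swap])
      (auto simp: ascending_def descending_def)
  finally show ?thesis
    by (simp add: ascending_def sum.distrib case_prod_unfold)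
qed

locale chord_diagram =
  fixes P :: "'a::linordered_idom set" and mate :: "'a \<Rightarrow> 'a"
  assumes finite_points: "finite P"
    and mate_in: "x \<in> P \<Longrightarrow> mate x \<in> P"
    and mate_mate: "x \<in> P \<Longrightarrow> mate (mate x) = x"
    and mate_neq: "x \<in> P \<Longrightarrow> mate x \<noteq> x"
begin

definition openers :: "'a set" where
  "openers = {a \<in> P. a < mate a}"

definition crossing :: "('a \<times> 'a) set" where
  "crossing = {(a, b) \<in> openers \<times> openers. a < b \<and> b < mate a \<and> mate a < mate b}"

definition separated :: "('a \<times> 'a) set" where
  "separated = {(a, b) \<in> openers \<times> openers. mate a < b}"

definition nested :: "('a \<times> 'a) set" where
  "nested = {(a, b) \<in> openers \<times> openers. a < b \<and> mate b < mate a}"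

lemma finite_openers: "finite openers"
  using finite_points by (simp add: openers_def)

lemma openers_in_points: "a \<in> openers \<Longrightarrow> a \<in> P"
  by (simp add: openers_def)

lemma opener_less_mate: "a \<in> openers \<Longrightarrow> a < mate a"
  by (simp add: openers_def)

lemma mate_mate_opener: "a \<in> openers \<Longrightarrow> mate (mate a) = a"
  by (simp add: openers_def mate_mate)

lemma points_eq_openers_Un_mates: "P = openers \<union> mate ` openers"
proof (intro equalityI subsetI)
  fix x assume x: "x \<in> P"
  show "x \<in> openers \<union> mate ` openers"
  proof (cases "x < mate x")
    case False
    then have "mate x \<in> openers"
      using x mate_in mate_mate mate_neq[OF x] by (simp add: openers_def)
    then show ?thesis
      using mate_mate[OF x] by (metis UnI2 imageI)
  qed (use x in \<open>simp add: openers_def\<close>)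
qed (auto simp: openers_def mate_in)

lemma sum_points_eq_sum_openers:
  fixes g :: "'a \<Rightarrow> 'b::comm_monoid_add"
  shows "(\<Sum>x\<in>P. g x) = (\<Sum>a\<in>openers. g a + g (mate a))"
proof -
  have "inj_on mate openers"
    by (metis inj_onI mate_mate_opener)
  moreover have "openers \<inter> mate ` openers = {}"
    using mate_mate by (force simp: openers_def)
  ultimately show ?thesis
    using finite_openers
    by (subst points_eq_openers_Un_mates)
      (simp add: sum.union_disjoint sum.reindex sum.distrib)
qed

lemma card_points: "card P = 2 * card openers"
  using sum_points_eq_sum_openers[of "\<lambda>_. 1 :: nat"] by simp

lemma opener_pairs_partition:
  "{(a, b) \<in> openers \<times> openers. a < b} = crossing \<union> separated \<union> nested"
proof -
  have "mate a \<noteq> b" if "a \<in> openers" "b \<in> openers" for a b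
    using that by (metis mate_mate_opener opener_less_mate order_less_asym)
  moreover have "mate a \<noteq> mate b" if "a \<in> openers" "b \<in> openers" "a < b" for a b
    using that by (metis mate_mate_opener order_less_irrefl)
  ultimately show ?thesis
    by (auto simp: crossing_def separated_def nested_def neq_iff dest: opener_less_mate)
qed

lemma pair_kinds_disjoint:
  "crossing \<inter> separated = {}" "(crossing \<union> separated) \<inter> nested = {}"
  by (auto simp: crossing_def separated_def nested_def dest: opener_less_mate)

lemma finite_pair_kinds: "finite crossing" "finite separated" "finite nested"
  using finite_openers
  by (auto intro: finite_subset[of _ "openers \<times> openers"]
      simp: crossing_def separated_def nested_def)

lemma sum_opener_pairs:
  fixes F :: "'a \<Rightarrow> 'a \<Rightarrow> 'b::comm_semiring_1"
  assumes diagonal: "\<And>a. a \<in> openers \<Longrightarrow> F a a = d"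
    and crossing: "\<And>a b. (a, b) \<in> crossing \<Longrightarrow> F a b + F b a = c"
    and separated: "\<And>a b. (a, b) \<in> separated \<Longrightarrow> F a b + F b a = s"
    and nested: "\<And>a b. (a, b) \<in> nested \<Longrightarrow> F a b + F b a = e"
  shows "(\<Sum>a\<in>openers. \<Sum>b\<in>openers. F a b) = of_nat (card openers) * d
    + of_nat (card crossing) * c + of_nat (card separated) * s + of_nat (card nested) * e"
proof -
  let ?G = "\<lambda>(a, b). F a b + F b a"
  have "(\<Sum>a\<in>openers. \<Sum>b\<in>openers. F a b)
      = (\<Sum>a\<in>openers. F a a) + sum ?G (crossing \<union> separated \<union> nested)"
    unfolding sum_Times_linorder[OF finite_openers] opener_pairs_partition ..
  also have "sum ?G (crossing \<union> separated \<union> nested)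
      = sum ?G crossing + sum ?G separated + sum ?G nested"
    by (simp add: sum.union_disjoint finite_pair_kinds pair_kinds_disjoint)
  also have "sum ?G crossing = (\<Sum>_\<in>crossing. c)"
    by (rule sum.cong) (use crossing in auto)
  also have "sum ?G separated = (\<Sum>_\<in>separated. s)"
    by (rule sum.cong) (use separated in auto)
  also have "sum ?G nested = (\<Sum>_\<in>nested. e)"
    by (rule sum.cong) (use nested in auto)
  finally show ?thesis
    by (simp add: diagonal add.assoc)
qed

lemma card_crossing_plus_separated_plus_nested:
  "8 * int (card crossing + card separated + card nested) = int (card P) * (int (card P) - 2)"
proof -
  have "(\<Sum>a\<in>openers. \<Sum>b\<in>openers. 1 :: int) = of_nat (card openers) * 1
      + of_nat (card crossing) * 2 + of_nat (card separated) * 2 + of_nat (card nested) * 2"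
    by (rule sum_opener_pairs) simp_all
  then have "2 * int (card crossing + card separated + card nested)
      = int (card openers) * (int (card openers) - 1)"
    by (simp add: algebra_simps)
  then show ?thesis
    by (simp add: card_points algebra_simps)
qed

lemma sum_card_enclosed_points:
  "(\<Sum>a\<in>openers. card {y \<in> P. a < y \<and> y < mate a}) = 2 * (card crossing + card nested)"
proof -
  let ?encl = "\<lambda>a y. of_bool (a < y \<and> y < mate a) :: nat"
  have "card {y \<in> P. a < y \<and> y < mate a} = (\<Sum>y\<in>P. ?encl a y)" for a
    using finite_points by (simp add: Int_def)
  then have "(\<Sum>a\<in>openers. card {y \<in> P. a < y \<and> y < mate a})
      = (\<Sum>a\<in>openers. \<Sum>b\<in>openers. ?encl a b + ?encl a (mate b))"
    by (simp only: sum_points_eq_sum_openers)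
  also have "\<dots> = of_nat (card openers) * 0 + of_nat (card crossing) * 2
      + of_nat (card separated) * 0 + of_nat (card nested) * 2"
    by (rule sum_opener_pairs)
      (auto simp: crossing_def separated_def nested_def dest: opener_less_mate)
  finally show ?thesis
    by simp
qed

lemma sum_sgn_mate:
  "(\<Sum>x\<in>P. \<Sum>y\<in>P. sgn (y - x) * sgn (mate y - mate x))
    = 8 * (of_nat (card separated) - of_nat (card nested)) - of_nat (card P)"
proof -
  let ?g = "\<lambda>x y. sgn (y - x) * sgn (mate y - mate x)"
  let ?F = "\<lambda>a b. ?g a b + ?g a (mate b) + (?g (mate a) b + ?g (mate a) (mate b))"
  have "(\<Sum>x\<in>P. \<Sum>y\<in>P. ?g x y) = (\<Sum>a\<in>openers. \<Sum>b\<in>openers. ?F a b)"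
    by (simp only: sum_points_eq_sum_openers sum.distrib)
  also have "\<dots> = of_nat (card openers) * (- 2) + of_nat (card crossing) * 0
      + of_nat (card separated) * 8 + of_nat (card nested) * (- 8)"
  proof (rule sum_opener_pairs)
    fix a assume "a \<in> openers"
    then show "?F a a = - 2"
      by (simp add: mate_mate_opener opener_less_mate)
  next
    fix a b
    note less_mate = opener_less_mate[of a] opener_less_mate[of b]
    show "?F a b + ?F b a = 0" if "(a, b) \<in> crossing"
      using that less_mate by (auto simp: crossing_def mate_mate_opener)
    show "?F a b + ?F b a = 8" if "(a, b) \<in> separated"
      using that less_mate by (auto simp: separated_def mate_mate_opener)
    show "?F a b + ?F b a = - 8" if "(a, b) \<in> nested"
      using that less_mate by (auto simp: nested_def mate_mate_opener)
  qed
  finally show ?thesis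
    by (simp add: card_points algebra_simps)
qed

end

subsection \<open>Sums over residues\<close>

lemma sum_residues_affine:
  fixes g :: "int \<Rightarrow> 'a::comm_monoid_add"
  assumes "0 < p" and "coprime c p"
    and periodic: "\<And>x y. [x = y] (mod p) \<Longrightarrow> g x = g y"
  shows "(\<Sum>x\<in>{0..<p}. g (c * x + d)) = (\<Sum>x\<in>{0..<p}. g x)"
proof -
  let ?h = "\<lambda>x. (c * x + d) mod p"
  have inj: "inj_on ?h {0..<p}"
  proof (rule inj_onI)
    fix x y assume xy: "x \<in> {0..<p}" "y \<in> {0..<p}" and "?h x = ?h y"
    then have "[c * x = c * y] (mod p)"
      by (metis cong_add_rcancel cong_def)
    then have "[x = y] (mod p)"
      using \<open>coprime c p\<close> by (simp add: cong_mult_lcancel)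
    then show "x = y"
      using xy by (simp add: cong_def)
  qed
  moreover have "?h ` {0..<p} \<subseteq> {0..<p}"
    using \<open>0 < p\<close> by auto
  ultimately have "?h ` {0..<p} = {0..<p}"
    by (simp add: endo_inj_surj)
  then have "(\<Sum>x\<in>{0..<p}. g x) = (\<Sum>x\<in>{0..<p}. g (?h x))"
    using sum.reindex[OF inj, of g] by simp
  also have "\<dots> = (\<Sum>x\<in>{0..<p}. g (c * x + d))"
    by (intro sum.cong refl periodic) simp
  finally show ?thesis ..
qed

lemma sum_residues_rotate:
  fixes h :: "int \<Rightarrow> int \<Rightarrow> 'a::comm_monoid_add"
  assumes "0 < p" and "odd p"
    and periodic: "\<And>x x' y y'. [x = x'] (mod p) \<Longrightarrow> [y = y'] (mod p) \<Longrightarrow> h x y = h x' y'"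
  shows "(\<Sum>x\<in>{0..<p}. \<Sum>y\<in>{0..<p}. h x y) = (\<Sum>u\<in>{0..<p}. \<Sum>v\<in>{0..<p}. h (v - u) (v + u))"
proof -
  have "(\<Sum>x\<in>{0..<p}. \<Sum>y\<in>{0..<p}. h x y) = (\<Sum>v\<in>{0..<p}. \<Sum>u\<in>{0..<p}. h v (2 * u + v))"
    using assms by (intro sum.cong refl sum_residues_affine[symmetric]) (auto intro: periodic)
  also have "\<dots> = (\<Sum>u\<in>{0..<p}. \<Sum>v\<in>{0..<p}. h v (2 * u + v))"
    by (rule sum.swap)
  also have "\<dots> = (\<Sum>u\<in>{0..<p}. \<Sum>v\<in>{0..<p}. h (1 * v + - u) (2 * u + (1 * v + - u)))"
  proof (rule sum.cong[OF refl])
    fix u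
    show "(\<Sum>v\<in>{0..<p}. h v (2 * u + v)) = (\<Sum>v\<in>{0..<p}. h (1 * v + - u) (2 * u + (1 * v + - u)))"
      using sum_residues_affine[of p 1 "\<lambda>v. h v (2 * u + v)" "- u"] \<open>0 < p\<close>
      by (simp add: periodic cong_add)
  qed
  finally show ?thesis
    by (simp add: algebra_simps)
qed

lemma sum_residues_even:
  fixes g :: "int \<Rightarrow> 'a::comm_semiring_1"
  assumes "0 < p" and "odd p"
    and periodic: "\<And>x y. [x = y] (mod p) \<Longrightarrow> g x = g y"
    and even: "\<And>x. g (- x) = g x"
  shows "(\<Sum>x\<in>{0..<p}. g x) = g 0 + 2 * (\<Sum>x\<in>{1..p div 2}. g x)"
proof -
  have p_eq: "p = 2 * (p div 2) + 1"
    using \<open>odd p\<close> by simp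
  have split: "{0..<p} = insert 0 ({1..p div 2} \<union> {p div 2 + 1..<p})"
    using \<open>0 < p\<close> by auto
  have "(\<Sum>x\<in>{p div 2 + 1..<p}. g x) = (\<Sum>x\<in>{1..p div 2}. g (p - x))"
    by (rule sum.reindex_bij_witness[where i = "\<lambda>x. p - x" and j = "\<lambda>x. p - x"])
      (use p_eq in auto)
  also have "\<dots> = (\<Sum>x\<in>{1..p div 2}. g x)"
  proof (rule sum.cong[OF refl])
    fix x
    have "g (p - x) = g (- x)"
      by (rule periodic) (simp add: cong_iff_dvd_diff)
    then show "g (p - x) = g x"
      by (simp add: even)
  qed
  finally have "(\<Sum>x\<in>{p div 2 + 1..<p}. g x) = (\<Sum>x\<in>{1..p div 2}. g x)" .
  moreover have "{1..p div 2} \<inter> {p div 2 + 1..<p} = {}"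
    by auto
  ultimately show ?thesis
    unfolding split using \<open>0 < p\<close> by (simp add: sum.union_disjoint mult_2)
qed

lemma sum_half_residues_mult:
  fixes g :: "int \<Rightarrow> 'a::{idom, ring_char_0}"
  assumes "0 < p" and "odd p" and "coprime c p"
    and periodic: "\<And>x y. [x = y] (mod p) \<Longrightarrow> g x = g y"
    and even: "\<And>x. g (- x) = g x"
  shows "(\<Sum>x\<in>{1..p div 2}. g (c * x)) = (\<Sum>x\<in>{1..p div 2}. g x)"
proof -
  have "g 0 + 2 * (\<Sum>x\<in>{1..p div 2}. g (c * x)) = (\<Sum>x\<in>{0..<p}. g (c * x))"
    using sum_residues_even[of p "\<lambda>x. g (c * x)"] assms(1,2)
    by (simp add: even periodic cong_scalar_left)
  also have "\<dots> = (\<Sum>x\<in>{0..<p}. g x)"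
    using sum_residues_affine[of p c g 0] assms by simp
  also have "\<dots> = g 0 + 2 * (\<Sum>x\<in>{1..p div 2}. g x)"
    using assms by (intro sum_residues_even)
  finally show ?thesis
    by simp
qed

lemma sum_sum_residues_even:
  fixes h :: "int \<Rightarrow> int \<Rightarrow> 'a::comm_semiring_1"
  assumes "0 < p" and "odd p"
    and periodic: "\<And>x x' y y'. [x = x'] (mod p) \<Longrightarrow> [y = y'] (mod p) \<Longrightarrow> h x y = h x' y'"
    and even: "\<And>x y. h (- x) y = h x y" "\<And>x y. h x (- y) = h x y"
  shows "(\<Sum>x\<in>{0..<p}. \<Sum>y\<in>{0..<p}. h x y)
    = h 0 0 + 2 * (\<Sum>y\<in>{1..p div 2}. h 0 y) + 2 * (\<Sum>x\<in>{1..p div 2}. h x 0)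
      + 4 * (\<Sum>x\<in>{1..p div 2}. \<Sum>y\<in>{1..p div 2}. h x y)"
proof -
  have "(\<Sum>y\<in>{0..<p}. h x y) = h x 0 + 2 * (\<Sum>y\<in>{1..p div 2}. h x y)" for x
    using assms by (intro sum_residues_even) auto
  moreover have "(\<Sum>x\<in>{0..<p}. \<Sum>y\<in>{0..<p}. h x y)
      = (\<Sum>y\<in>{0..<p}. h 0 y) + 2 * (\<Sum>x\<in>{1..p div 2}. \<Sum>y\<in>{0..<p}. h x y)"
    using assms by (intro sum_residues_even sum.cong) auto
  ultimately show ?thesis
    by (simp add: sum.distrib sum_distrib_left algebra_simps)
qed

subsection \<open>The distance to the nearest multiple\<close>

lemma tilde_eq_min: "tilde p x = min (x mod p) (p - x mod p)"
  unfolding tilde_def min_def by auto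

lemma tilde_cong: "[x = y] (mod p) \<Longrightarrow> tilde p x = tilde p y"
  by (simp add: tilde_eq_min cong_def)

lemma tilde_minus: "tilde p (- x) = tilde p x"
  by (auto simp: tilde_eq_min zmod_zminus1_eq_if min.commute)

lemma tilde_diff_commute: "tilde p (x - y) = tilde p (y - x)"
  using tilde_minus[of p "x - y"] by simp

lemma tilde_nonneg: "0 < p \<Longrightarrow> 0 \<le> tilde p x"
  by (simp add: tilde_eq_min order_less_imp_le)

lemma tilde_le_half: "2 * tilde p x \<le> p"
  by (simp add: tilde_eq_min min_def)

lemma tilde_eq_self: "0 < p \<Longrightarrow> 0 \<le> x \<Longrightarrow> 2 * x \<le> p \<Longrightarrow> tilde p x = x"
  by (simp add: tilde_eq_min)

lemma tilde_eq_0_iff: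
  assumes "0 < p"
  shows "tilde p x = 0 \<longleftrightarrow> p dvd x"
  using pos_mod_bound[OF assms, of x] by (auto simp: tilde_eq_min min_def dvd_eq_mod_eq_0)

lemma tilde_mult_pos:
  assumes "0 < p" and "coprime c p" and "x \<in> {1..p div 2}"
  shows "0 < tilde p (c * x)"
proof -
  have "\<not> p dvd x"
    using assms zdvd_imp_le[of p x] by auto
  then have "\<not> p dvd c * x"
    using assms(2) by (simp add: coprime_commute coprime_dvd_mult_right_iff)
  then show ?thesis
    using tilde_eq_0_iff[OF assms(1), of "c * x"] tilde_nonneg[OF assms(1), of "c * x"] by simp
qed

lemma tilde_cases:
  obtains (same) "[tilde p x = x] (mod p)" | (opposite) "[tilde p x = - x] (mod p)"
proof (cases "x mod p \<le> p - x mod p")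
  case True
  then show ?thesis
    using same by (simp add: tilde_eq_min min_def)
next
  case False
  moreover have "[p - x mod p = 0 - x] (mod p)"
    by (intro cong_diff) (simp_all add: cong_def)
  ultimately show ?thesis
    using opposite by (simp add: tilde_eq_min min_def)
qed

lemma tilde_mult_tilde: "tilde p (c * tilde p x) = tilde p (c * x)"
proof (cases rule: tilde_cases[of p x])
  case same
  then show ?thesis
    by (intro tilde_cong cong_scalar_left)
next
  case opposite
  then have "tilde p (c * tilde p x) = tilde p (c * - x)"
    by (intro tilde_cong cong_scalar_left)
  then show ?thesis
    by (simp add: tilde_minus)
qed

lemma min_tilde_diff_add_tilde:
  "min (tilde p (tilde p x - y)) (tilde p (tilde p x + y))
    = min (tilde p (x - y)) (tilde p (x + y))"
proof (cases rule: tilde_cases[of p x])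
  case same
  have "tilde p (tilde p x - y) = tilde p (x - y)" "tilde p (tilde p x + y) = tilde p (x + y)"
    by (rule tilde_cong[OF cong_diff[OF same cong_refl]],
        rule tilde_cong[OF cong_add[OF same cong_refl]])
  then show ?thesis
    by simp
next
  case opposite
  have "tilde p (tilde p x - y) = tilde p (- x - y)" "tilde p (tilde p x + y) = tilde p (- x + y)"
    by (rule tilde_cong[OF cong_diff[OF opposite cong_refl]],
        rule tilde_cong[OF cong_add[OF opposite cong_refl]])
  moreover have "tilde p (- x - y) = tilde p (x + y)" "tilde p (- x + y) = tilde p (x - y)"
    using tilde_minus[of p "x + y"] tilde_minus[of p "x - y"] by simp_all
  ultimately show ?thesis
    by (simp add: min.commute)
qed

lemma abs_diff_tilde:
  assumes "0 < p"
  shows "\<bar>tilde p x - tilde p y\<bar> = min (tilde p (x - y)) (tilde p (x + y))"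
proof -
  define a b where "a = tilde p x" and "b = tilde p y"
  have bounds: "0 \<le> a" "2 * a \<le> p" "0 \<le> b" "2 * b \<le> p"
    using assms by (simp_all add: a_def b_def tilde_nonneg tilde_le_half)
  have "tilde p (a - b) = tilde p \<bar>a - b\<bar>"
    by (simp add: abs_if tilde_diff_commute)
  also have "\<dots> = \<bar>a - b\<bar>"
    using bounds assms by (intro tilde_eq_self) (auto simp: abs_if)
  finally have "tilde p (a - b) = \<bar>a - b\<bar>" .
  moreover have "\<bar>a - b\<bar> \<le> tilde p (a + b)"
  proof (cases "a + b = p")
    case False
    then have "(a + b) mod p = a + b"
      using bounds by simp
    then show ?thesis
      using bounds by (simp add: tilde_eq_min abs_le_iff)
  qed (use bounds assms tilde_nonneg in auto)
  ultimately have "\<bar>a - b\<bar> = min (tilde p (a - b)) (tilde p (a + b))"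
    by simp
  also have "\<dots> = min (tilde p (x - b)) (tilde p (x + b))"
    unfolding a_def by (rule min_tilde_diff_add_tilde)
  also have "\<dots> = min (tilde p (b - x)) (tilde p (b + x))"
    by (simp add: tilde_diff_commute add.commute)
  also have "\<dots> = min (tilde p (x - y)) (tilde p (x + y))"
    unfolding b_def min_tilde_diff_add_tilde by (simp add: tilde_diff_commute add.commute)
  finally show ?thesis
    by (simp add: a_def b_def)
qed

definition residue_angle :: "int \<Rightarrow> int \<Rightarrow> real" where
  "residue_angle p x = 2 * pi * real_of_int x / real_of_int p"

lemma residue_angle_add: "residue_angle p (x + y) = residue_angle p x + residue_angle p y"
  by (simp add: residue_angle_def add_divide_distrib distrib_left)

lemma residue_angle_minus: "residue_angle p (- x) = - residue_angle p x"
  by (simp add: residue_angle_def)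

lemma residue_angle_diff: "residue_angle p (x - y) = residue_angle p x - residue_angle p y"
  using residue_angle_add[of p x "- y"] by (simp add: residue_angle_minus)

lemma sin_cos_residue_angle_cong:
  assumes "0 < p" and "[x = y] (mod p)"
  shows "sin (residue_angle p x) = sin (residue_angle p y)"
    and "cos (residue_angle p x) = cos (residue_angle p y)"
proof -
  obtain k where "x = y + p * k"
    using assms(2) by (metis cong_iff_lin cong_sym)
  then have "residue_angle p x = residue_angle p y + 2 * pi * real_of_int k"
    using assms(1) by (simp add: residue_angle_def field_simps)
  then show "sin (residue_angle p x) = sin (residue_angle p y)"
    "cos (residue_angle p x) = cos (residue_angle p y)"
    using sin_cos_eq_iff by blast+
qed

lemma cos_residue_angle_tilde:
  assumes "0 < p"
  shows "cos (residue_angle p (tilde p x)) = cos (residue_angle p x)"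
  using sin_cos_residue_angle_cong(2)[OF assms]
  by (cases rule: tilde_cases[of p x]) (simp_all add: residue_angle_minus)

lemma tilde_less_iff_cos:
  assumes "0 < p"
  shows "tilde p x < tilde p y \<longleftrightarrow> cos (residue_angle p y) < cos (residue_angle p x)"
proof -
  have range: "0 \<le> residue_angle p (tilde p z)" "residue_angle p (tilde p z) \<le> pi" for z
  proof -
    have "real_of_int (2 * tilde p z) \<le> real_of_int p"
      using tilde_le_half by (simp only: of_int_le_iff)
    then show "0 \<le> residue_angle p (tilde p z)" "residue_angle p (tilde p z) \<le> pi"
      using assms tilde_nonneg[OF assms, of z] by (simp_all add: residue_angle_def field_simps)
  qed
  have "tilde p x < tilde p y \<longleftrightarrow> residue_angle p (tilde p x) < residue_angle p (tilde p y)"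
    using assms by (simp add: residue_angle_def divide_less_cancel)
  also have "\<dots> \<longleftrightarrow> cos (residue_angle p (tilde p y)) < cos (residue_angle p (tilde p x))"
    using range by (simp add: cos_mono_less_eq)
  finally show ?thesis
    by (simp add: cos_residue_angle_tilde assms)
qed

lemma sgn_tilde_add_minus_tilde_diff:
  assumes "0 < p"
  shows "real_of_int (sgn (tilde p (v + u) - tilde p (v - u)))
    = sgn (sin (residue_angle p u)) * sgn (sin (residue_angle p v))"
proof -
  have "real_of_int (sgn (tilde p (v + u) - tilde p (v - u)))
      = sgn (cos (residue_angle p (v - u)) - cos (residue_angle p (v + u)))"
    using tilde_less_iff_cos[OF assms, of "v + u" "v - u"]
      tilde_less_iff_cos[OF assms, of "v - u" "v + u"]
    by (auto simp: sgn_if)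
  also have "cos (residue_angle p (v - u)) - cos (residue_angle p (v + u))
      = 2 * (sin (residue_angle p v) * sin (residue_angle p u))"
    by (simp add: residue_angle_add residue_angle_diff sin_times_sin)
  finally show ?thesis
    by (simp add: sgn_mult)
qed

subsection \<open>Square roots of \<open>- 1\<close>\<close>

locale sqrt_minus_one_mod =
  fixes p t :: int
  assumes p_pos: "0 < p" and odd_p: "odd p" and t_square: "[t * t = - 1] (mod p)"
begin

abbreviation bar :: "int \<Rightarrow> int" where
  "bar x \<equiv> tilde p (t * x)"

lemma bar_cong: "[x = y] (mod p) \<Longrightarrow> bar x = bar y"
  by (intro tilde_cong cong_scalar_left)

lemma t_mult_t_mult: "[t * (t * x) = - x] (mod p)"
  using cong_scalar_right[OF t_square, of x] by (simp add: mult.assoc)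

lemma coprime_t: "coprime t p"
proof -
  have "coprime (t * t) p"
    using t_square by (rule cong_imp_coprime[OF cong_sym]) simp
  then show ?thesis
    by simp
qed

lemma coprime_t_minus_1_t_plus_1: "coprime (t - 1) p" "coprime (t + 1) p"
proof -
  have "[(t - 1) * (t + 1) = - 2] (mod p)"
    using cong_diff[OF t_square cong_refl[of 1]] by (simp add: algebra_simps)
  then have "coprime ((t - 1) * (t + 1)) p"
    by (rule cong_imp_coprime[OF cong_sym]) (simp add: odd_p)
  then show "coprime (t - 1) p" "coprime (t + 1) p"
    by simp_all
qed

lemma tilde_half_residue: "x \<in> {1..p div 2} \<Longrightarrow> tilde p x = x"
  using p_pos by (intro tilde_eq_self) auto

lemma abs_bar_diff:
  assumes "x \<in> {1..p div 2}"
  shows "\<bar>bar x - x\<bar> = min (tilde p ((t - 1) * x)) (tilde p ((t + 1) * x))"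
  using abs_diff_tilde[OF p_pos, of "t * x" x] tilde_half_residue[OF assms]
  by (simp add: algebra_simps)

sublocale chord_diagram "{1..p div 2}" bar
proof
  fix x assume x: "x \<in> {1..p div 2}"
  show "bar x \<in> {1..p div 2}"
    using tilde_mult_pos[OF p_pos coprime_t x] tilde_le_half[of p "t * x"] by auto
  have "bar (bar x) = tilde p (t * (t * x))"
    by (rule tilde_mult_tilde)
  also have "\<dots> = tilde p x"
    using tilde_cong[OF t_mult_t_mult, of x] by (simp add: tilde_minus)
  finally show "bar (bar x) = x"
    using x by (simp add: tilde_half_residue)
  have "0 < \<bar>bar x - x\<bar>"
    using coprime_t_minus_1_t_plus_1 x by (simp add: abs_bar_diff p_pos tilde_mult_pos)
  then show "bar x \<noteq> x"
    by simp
qed simp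

lemma sum_abs_bar_diff_eq_sum_min:
  "(\<Sum>x\<in>{1..p div 2}. \<bar>bar x - x\<bar>) = (\<Sum>x\<in>{1..p div 2}. min x (bar x))"
proof -
  let ?g = "\<lambda>x. min (tilde p x) (bar x)"
  have "bar ((t - 1) * x) = tilde p ((t + 1) * x)" for x
  proof -
    have "[t * (t * x) - t * x = - x - t * x] (mod p)"
      by (intro cong_diff t_mult_t_mult cong_refl)
    then have "bar ((t - 1) * x) = tilde p (- ((t + 1) * x))"
      by (intro tilde_cong) (simp add: algebra_simps)
    then show ?thesis
      by (simp only: tilde_minus)
  qed
  then have "(\<Sum>x\<in>{1..p div 2}. \<bar>bar x - x\<bar>) = (\<Sum>x\<in>{1..p div 2}. ?g ((t - 1) * x))"
    by (intro sum.cong refl) (simp add: abs_bar_diff)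
  also have "\<dots> = (\<Sum>x\<in>{1..p div 2}. ?g x)"
  proof (rule sum_half_residues_mult)
    show "?g x = ?g y" if "[x = y] (mod p)" for x y
      using tilde_cong[OF that] bar_cong[OF that] by simp
  qed (simp_all add: p_pos odd_p coprime_t_minus_1_t_plus_1 tilde_minus)
  also have "\<dots> = (\<Sum>x\<in>{1..p div 2}. min x (bar x))"
    by (intro sum.cong refl) (simp add: tilde_half_residue)
  finally show ?thesis .
qed

lemma sum_abs_bar_diff:
  "3 * (\<Sum>x\<in>{1..p div 2}. \<bar>bar x - x\<bar>) = (p div 2) * (p div 2 + 1)"
proof -
  have "3 * (\<Sum>x\<in>{1..p div 2}. \<bar>bar x - x\<bar>) = (\<Sum>x\<in>{1..p div 2}. \<bar>bar x - x\<bar> + 2 * min x (bar x))"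
    by (simp add: sum.distrib sum_distrib_left[symmetric] sum_abs_bar_diff_eq_sum_min)
  also have "\<dots> = (\<Sum>x\<in>{1..p div 2}. x + bar x)"
    by (intro sum.cong refl) auto
  also have "\<dots> = 2 * \<Sum>{1..p div 2}"
    using sum_half_residues_mult[OF p_pos odd_p coprime_t, of "tilde p"]
    by (simp add: sum.distrib tilde_cong tilde_minus tilde_half_residue)
  also have "\<dots> = (p div 2) * (p div 2 + 1)"
    using Sum_Icc_int[of 1 "p div 2"] p_pos by (cases "p div 2 = 0") auto
  finally show ?thesis .
qed

lemma sum_sgn_sin_residue_angle:
  "(\<Sum>u\<in>{0..<p}. sgn (sin (residue_angle p u)) * sgn (sin (residue_angle p (t * u)))) = 0"
proof -
  let ?s = "\<lambda>u. sgn (sin (residue_angle p u))"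
  let ?g = "\<lambda>u. ?s u * ?s (t * u)"
  have s_cong: "?s x = ?s y" if "[x = y] (mod p)" for x y
    using sin_cos_residue_angle_cong(1)[OF p_pos that] by simp
  have "(\<Sum>u\<in>{0..<p}. ?g u) = (\<Sum>u\<in>{0..<p}. ?g (t * u + 0))"
    using p_pos coprime_t
    by (intro sum_residues_affine[symmetric])
      (auto intro!: arg_cong2[where f = "(*)"] s_cong cong_scalar_left)
  also have "\<dots> = (\<Sum>u\<in>{0..<p}. - ?g u)"
    by (intro sum.cong refl) (simp add: s_cong[OF t_mult_t_mult] residue_angle_minus)
  finally show ?thesis
    by (simp add: sum_negf)
qed

definition concordance :: "int \<Rightarrow> int \<Rightarrow> int" where
  "concordance x y = sgn (tilde p y - tilde p x) * sgn (bar y - bar x)"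

lemma concordance_cong:
  assumes "[x = x'] (mod p)" and "[y = y'] (mod p)"
  shows "concordance x y = concordance x' y'"
  using assms[THEN tilde_cong] assms[THEN bar_cong] by (simp add: concordance_def)

lemma concordance_minus:
  "concordance (- x) y = concordance x y" "concordance x (- y) = concordance x y"
  by (simp_all add: concordance_def tilde_minus)

lemma sum_residues_concordance: "(\<Sum>x\<in>{0..<p}. \<Sum>y\<in>{0..<p}. concordance x y) = 0"
proof -
  let ?s = "\<lambda>u. sgn (sin (residue_angle p u))"
  have "real_of_int (concordance (v - u) (v + u)) = (?s u * ?s (t * u)) * (?s v * ?s (t * v))"
    for u v
    by (simp add: concordance_def distrib_left right_diff_distrib
        sgn_tilde_add_minus_tilde_diff[OF p_pos])
  then have "real_of_int (\<Sum>u\<in>{0..<p}. \<Sum>v\<in>{0..<p}. concordance (v - u) (v + u))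
      = (\<Sum>u\<in>{0..<p}. ?s u * ?s (t * u)) * (\<Sum>v\<in>{0..<p}. ?s v * ?s (t * v))"
    by (simp add: sum_product)
  also have "\<dots> = 0"
    by (simp add: sum_sgn_sin_residue_angle)
  finally have "(\<Sum>u\<in>{0..<p}. \<Sum>v\<in>{0..<p}. concordance (v - u) (v + u)) = 0"
    by (simp only: of_int_eq_0_iff)
  then show ?thesis
    using sum_residues_rotate[OF p_pos odd_p, of concordance, OF concordance_cong] by simp
qed

lemma sum_sgn_bar:
  "(\<Sum>x\<in>{1..p div 2}. \<Sum>y\<in>{1..p div 2}. sgn (y - x) * sgn (bar y - bar x)) = - (p div 2)"
proof -
  let ?H = "{1..p div 2}"
  have tilde_0: "tilde p 0 = 0"
    using p_pos by (simp add: tilde_eq_self)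
  have pos: "0 < tilde p x" "0 < bar x" if "x \<in> ?H" for x
    using that tilde_mult_pos[OF p_pos, of 1 x] tilde_mult_pos[OF p_pos coprime_t that] by simp_all
  have "concordance 0 x = 1" "concordance x 0 = 1" if "x \<in> ?H" for x
    using pos[OF that] by (simp_all add: concordance_def tilde_0)
  then have axes: "(\<Sum>x\<in>?H. concordance 0 x) = p div 2" "(\<Sum>x\<in>?H. concordance x 0) = p div 2"
    using p_pos by simp_all
  have "0 = concordance 0 0 + 2 * (\<Sum>y\<in>?H. concordance 0 y) + 2 * (\<Sum>x\<in>?H. concordance x 0)
      + 4 * (\<Sum>x\<in>?H. \<Sum>y\<in>?H. concordance x y)"
    using sum_sum_residues_even[OF p_pos odd_p, of concordance,
        OF concordance_cong concordance_minus]
    by (simp add: sum_residues_concordance)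
  then have "(\<Sum>x\<in>?H. \<Sum>y\<in>?H. concordance x y) = - (p div 2)"
    unfolding axes by (simp add: concordance_def)
  moreover have "concordance x y = sgn (y - x) * sgn (bar y - bar x)" if "x \<in> ?H" "y \<in> ?H" for x y
    using that by (simp add: concordance_def tilde_half_residue)
  ultimately show ?thesis
    by simp
qed

lemma card_separated_eq_card_nested: "card separated = card nested"
  using sum_sgn_mate p_pos by (simp add: sum_sgn_bar)

lemma card_crossing_plus_nested:
  "12 * int (card crossing + card nested) = (p div 2) * (p div 2 - 2)"
proof -
  have "bar a - a - 1 = int (card {y \<in> {1..p div 2}. a < y \<and> y < bar a})" if "a \<in> openers" for a
  proof -
    have "{y \<in> {1..p div 2}. a < y \<and> y < bar a} = {a<..<bar a}"
      using openers_in_points[OF that] mate_in[OF openers_in_points[OF that]] by auto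
    then show ?thesis
      using opener_less_mate[OF that] by simp
  qed
  then have enclosed: "(\<Sum>a\<in>openers. bar a - a - 1) = 2 * int (card crossing + card nested)"
    using arg_cong[OF sum_card_enclosed_points, of int] by simp
  have "(\<Sum>x\<in>{1..p div 2}. \<bar>bar x - x\<bar>) = (\<Sum>a\<in>openers. 2 * (bar a - a - 1) + 2)"
    unfolding sum_points_eq_sum_openers
    by (intro sum.cong refl) (auto simp: mate_mate_opener dest: opener_less_mate)
  also have "\<dots> = 4 * int (card crossing + card nested) + 2 * int (card openers)"
    by (simp only: sum.distrib sum_distrib_left[symmetric] enclosed) simp
  also have "2 * int (card openers) = p div 2"
    using card_points p_pos by simp
  finally show ?thesis
    using sum_abs_bar_diff by (simp add: distrib_left right_diff_distrib)
qed

theorem card_crossing: "24 * int (card crossing) = (p div 2) * (p div 2 - 2)"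
  and card_separated: "24 * int (card separated) = (p div 2) * (p div 2 - 2)"
  and card_nested: "24 * int (card nested) = (p div 2) * (p div 2 - 2)"
  using card_crossing_plus_separated_plus_nested card_crossing_plus_nested
    card_separated_eq_card_nested p_pos
  by simp_all

end

lemma odd_minus_1_div_2: "odd (p :: int) \<Longrightarrow> (p - 1) div 2 = p div 2"
  by presburger

lemma fact_eq_prod_int: "fact k = \<Prod>{1..int k}"
  using prod.atLeast_int_atMost_int_shift[of id 1 k] by (simp add: fact_prod)

lemma tval_square_cong:
  assumes "prime p" and "odd p"
  shows "[tval p * tval p = - ((- 1) ^ nat (p div 2))] (mod p)"
proof -
  have p_eq: "p = 2 * (p div 2) + 1" and "0 < p"
    using assms prime_gt_0_int by auto
  have tval: "tval p = \<Prod>{1..p div 2}"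
    using assms(2) by (simp add: tval_def odd_minus_1_div_2)
  have "[fact (nat p - 1) = (- 1 :: int)] (mod int (nat p))"
    using assms(1) prime_int_nat_transfer by (intro wilson_theorem) blast
  then have wilson: "[\<Prod>{1..p - 1} = - 1] (mod p)"
    using \<open>0 < p\<close> by (simp add: fact_eq_prod_int)
  have "\<Prod>{1..p - 1} = \<Prod>{1..p div 2} * \<Prod>{p div 2 + 1..p - 1}"
    using p_eq \<open>0 < p\<close> by (subst prod.union_disjoint[symmetric]) (auto intro!: prod.cong)
  also have "\<Prod>{p div 2 + 1..p - 1} = (\<Prod>x\<in>{1..p div 2}. p - x)"
    by (rule prod.reindex_bij_witness[where i = "\<lambda>x. p - x" and j = "\<lambda>x. p - x"])
      (use p_eq in auto)
  finally have split: "\<Prod>{1..p - 1} = tval p * (\<Prod>x\<in>{1..p div 2}. p - x)"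
    by (simp only: tval)
  have "[(\<Prod>x\<in>{1..p div 2}. p - x) = (\<Prod>x\<in>{1..p div 2}. - 1 * x)] (mod p)"
    by (intro cong_prod) (simp add: cong_iff_dvd_diff)
  also have "(\<Prod>x\<in>{1..p div 2}. - 1 * x) = (- 1) ^ nat (p div 2) * tval p"
    by (simp add: tval prod.distrib del: mult_minus_left mult_minus1)
  finally have "[- 1 = tval p * ((- 1) ^ nat (p div 2) * tval p)] (mod p)"
    using wilson unfolding split by (metis cong_scalar_left cong_sym cong_trans)
  from cong_scalar_left[OF this, of "(- 1) ^ nat (p div 2)"] show ?thesis
    by (simp add: cong_sym_eq mult_ac flip: power_add mult_2)
qed

theorem theorem3p5:
  fixes p :: int
  assumes "prime p" and "[p = 1] (mod 4)"
  shows "card (X p) = card (Y p) \<and> card (Y p) = card (Z p) \<and>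
    real (card (Z p)) = (real_of_int p - 1) * (real_of_int p - 5) / 96"
proof -
  have "0 < p" and "odd p" and "even (p div 2)" and double_half: "2 * (p div 2) = p - 1"
    using assms prime_gt_0_int[of p] by (simp_all add: cong_def) presburger+
  then interpret sqrt_minus_one_mod p "tval p"
    using tval_square_cong[OF assms(1)] by unfold_locales (simp_all add: even_nat_iff)
  have "V p = openers"
    using \<open>odd p\<close> by (auto simp: V_def openers_def odd_minus_1_div_2)
  then have chords: "X p = crossing" "Y p = separated" "Z p = nested"
    by (auto simp: X_def Y_def Z_def crossing_def separated_def nested_def pbar_def
        dest: opener_less_mate)
  have "96 * int (card nested) = (2 * (p div 2)) * (2 * (p div 2) - 4)"
    using card_nested by (simp add: algebra_simps)
  also have "\<dots> = (p - 1) * (p - 5)"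
    by (simp add: double_half)
  finally have "real_of_int (96 * int (card nested)) = real_of_int ((p - 1) * (p - 5))"
    by (rule arg_cong)
  then show ?thesis
    using card_crossing card_separated card_nested by (simp add: chords)
qed

end
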